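(* (i) Let $B_c\in\mathcal B(\mathcal H)$ with $-1\notin\Lambda(B_c)$, so that $M(-B_c)$ is well defined in $\mathcal B(\mathcal H)$. If the zero solution of $\dot x=-B_cx$ is exponentially stable and $B_c$ has hypocoercivity index $m\in\mathbb N_0$, then the zero solution of $x_{k+1}=B_dx_k$ with $B_d:=M(-B_c)$ is exponentially stable and $B_d$ has hypocontractivity index $m$. (ii) Let $B_d\in\mathcal B(\mathcal H)$ with $-1\notin\Lambda(B_d)$, so that $M^{-1}(B_d)$ is well defined in $\mathcal B(\mathcal H)$. If the zero solution of $x_{k+1}=B_dx_k$ is exponentially stable and $B_d$ has hypocontractivity index $m\in\mathbb N_0$, then the zero solution of $\dot x=-B_cx$ with $-B_c:=M^{-1}(B_d)$ is exponentially stable and $B_c$ has hypocoercivity index $m$.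
   Context: $\mathcal H$ is a separable complex Hilbert space, $\mathcal B(\mathcal H)$ the bounded linear operators on it, $\Lambda(A)$ the spectrum of $A$. The Cayley transform is $M(z)=\frac{1+z}{1-z}$, with inverse $M^{-1}(z)=\frac{z-1}{z+1}$; for operators $M(-B_c)=(I-B_c)(I+B_c)^{-1}$ and $M^{-1}(B_d)=(B_d-I)(B_d+I)^{-1}$. The zero solution of $\dot x=-B_cx$ is exponentially stable if there are $C\ge1,\lambda>0$ with $\|e^{-B_ct}x^0\|\le Ce^{-\lambda t}\|x^0\|$ for all $x^0\in\mathcal H$, $t\ge0$. The zero solution of $x_{k+1}=B_dx_k$ is exponentially stable if there are $C\ge1$, $0<\lambda<1$ with $\|B_d^kx^0\|\le C\lambda^k\|x^0\|$ for all $x^0\in\mathcal H$, $k\in\mathbb N_0$. Hypocoercivity index: defined for $B_c$ with $B_H:=\frac{B_c+B_c^*}2\ge0$ (i.e. $-B_c$ semi-dissipative) as the smallest $m\in\mathbb N_0$ (if it exists) such that $\sum_{j=0}^m(B_c^* )^jB_HB_c^j\ge\kappa I$ for some $\kappa>0$; "$B_c$ has hypocoercivity index $m$" includes $B_H\ge0$. Hypocontractivity index: defined for $B_d$ with $\|B_d\|\le1$ (semi-contractive) as the smallest $m\in\mathbb N_0$ (if it exists) such that $\sum_{j=0}^m(B_d^* )^j(I-B_d^*B_d)B_d^j\ge\kappa I$ for some $\kappa>0$; "$B_d$ has hypocontractivity index $m$" includes $\|B_d\|\le1$. *)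

theory Defs
  imports "HOL-Analysis.Analysis"
begin

text \<open>
  A complex Hilbert space is modelled as a real Hilbert space (so that the norm, topology and
  completeness are those of the library) carrying a compatible complex scalar multiplication and a
  complex inner product, linear in its first argument, whose real part is the real inner product.
  The zero space is not excluded. Separability is stated as a hypothesis where needed.
\<close>

class complex_hilbert = real_inner + complete_space +
  fixes scaleC :: "complex \<Rightarrow> 'a \<Rightarrow> 'a" (infixr "*\<^sub>C" 75)
    and cinner :: "'a \<Rightarrow> 'a \<Rightarrow> complex"
  assumes scaleC_add_right: "c *\<^sub>C (x + y) = c *\<^sub>C x + c *\<^sub>C y"
    and scaleC_add_left: "(c + d) *\<^sub>C x = c *\<^sub>C x + d *\<^sub>C x"
    and scaleC_scaleC: "c *\<^sub>C d *\<^sub>C x = (c * d) *\<^sub>C x"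
    and scaleC_of_real: "complex_of_real r *\<^sub>C x = r *\<^sub>R x"
    and cinner_add_left: "cinner (x + y) z = cinner x z + cinner y z"
    and cinner_scaleC_left: "cinner (c *\<^sub>C x) y = c * cinner x y"
    and cinner_commute: "cinner y x = cnj (cinner x y)"
    and Re_cinner: "Re (cinner x y) = inner x y"
begin

subclass banach ..

end

lemma bounded_linear_scaleC: "bounded_linear (\<lambda>x::'a::complex_hilbert. z *\<^sub>C x)"
proof (rule bounded_linear_intro[where K="cmod z"])
  fix x y :: 'a and r :: real
  show "z *\<^sub>C (x + y) = z *\<^sub>C x + z *\<^sub>C y"
    by (rule scaleC_add_right)
  show "z *\<^sub>C (r *\<^sub>R x) = r *\<^sub>R z *\<^sub>C x"
    by (simp add: scaleC_of_real[symmetric] scaleC_scaleC mult.commute)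
  have "cinner (z *\<^sub>C x) (z *\<^sub>C x) = z * cinner x (z *\<^sub>C x)"
    by (rule cinner_scaleC_left)
  also have "cinner x (z *\<^sub>C x) = cnj z * cnj (cinner x x)"
    using cinner_commute[of x "z *\<^sub>C x"] by (simp add: cinner_scaleC_left)
  also have "cnj (cinner x x) = cinner x x"
    by (rule cinner_commute[symmetric])
  also have "z * (cnj z * cinner x x) = complex_of_real ((cmod z)\<^sup>2) * cinner x x"
    by (simp only: mult.assoc[symmetric] complex_norm_square)
  finally have "inner (z *\<^sub>C x) (z *\<^sub>C x) = (cmod z)\<^sup>2 * inner x x"
    by (metis Re_cinner Re_complex_of_real Re_divide_of_real scaleR_conv_of_real scaleR_complex.simps(1))
  then have "(norm (z *\<^sub>C x))\<^sup>2 = (norm x * cmod z)\<^sup>2"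
    by (simp add: power2_norm_eq_inner power_mult_distrib)
  then show "norm (z *\<^sub>C x) \<le> norm x * cmod z"
    by simp
qed

subsection \<open>Bounded operators\<close>

text \<open>
  The type of library bounded linear maps contains all bounded real-linear operators, with the
  operator norm. \<open>bounded_ops\<close> is the algebra of bounded complex-linear operators inside it.
\<close>

definition bounded_ops :: "('a::complex_hilbert \<Rightarrow>\<^sub>L 'a) set" where
  "bounded_ops = {A. \<forall>c x. blinfun_apply A (c *\<^sub>C x) = c *\<^sub>C blinfun_apply A x}"

primrec op_pow :: "('a::real_normed_vector \<Rightarrow>\<^sub>L 'a) \<Rightarrow> nat \<Rightarrow> 'a \<Rightarrow>\<^sub>L 'a" where
  "op_pow A 0 = id_blinfun"
| "op_pow A (Suc n) = A o\<^sub>L op_pow A n"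

text \<open>The exponential series, convergent in operator norm; the library function \<open>exp\<close> is not
  available for this type, which is not an instance of the normed algebra classes.\<close>

definition op_exp :: "('a::banach \<Rightarrow>\<^sub>L 'a) \<Rightarrow> 'a \<Rightarrow>\<^sub>L 'a" where
  "op_exp A = (\<Sum>n. op_pow A n /\<^sub>R fact n)"

definition op_is_inverse ::
  "('a::complex_hilbert \<Rightarrow>\<^sub>L 'a) \<Rightarrow> ('a \<Rightarrow>\<^sub>L 'a) \<Rightarrow> bool" where
  "op_is_inverse A C \<longleftrightarrow> C \<in> bounded_ops \<and> A o\<^sub>L C = id_blinfun \<and> C o\<^sub>L A = id_blinfun"

definition op_inverse :: "('a::complex_hilbert \<Rightarrow>\<^sub>L 'a) \<Rightarrow> 'a \<Rightarrow>\<^sub>L 'a" where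
  "op_inverse A = (THE C. op_is_inverse A C)"

definition scalar_op :: "complex \<Rightarrow> 'a::complex_hilbert \<Rightarrow>\<^sub>L 'a" where
  "scalar_op z = Blinfun (\<lambda>x. z *\<^sub>C x)"

lemma scalar_op_apply [simp]: "blinfun_apply (scalar_op z) x = z *\<^sub>C x"
  by (simp add: scalar_op_def bounded_linear_Blinfun_apply bounded_linear_scaleC)

definition spectrum_op :: "('a::complex_hilbert \<Rightarrow>\<^sub>L 'a) \<Rightarrow> complex set" where
  "spectrum_op A = {z. \<nexists>C. op_is_inverse (A - scalar_op z) C}"

definition op_adjoint :: "('a::complex_hilbert \<Rightarrow>\<^sub>L 'a) \<Rightarrow> 'a \<Rightarrow>\<^sub>L 'a" where
  "op_adjoint A = (THE B. B \<in> bounded_ops \<and>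
     (\<forall>x y. cinner (blinfun_apply A x) y = cinner x (blinfun_apply B y)))"

definition op_nonneg :: "('a::complex_hilbert \<Rightarrow>\<^sub>L 'a) \<Rightarrow> bool" where
  "op_nonneg A \<longleftrightarrow> (\<forall>x. cinner (blinfun_apply A x) x \<in> \<real>\<^sub>\<ge>\<^sub>0)"

definition op_le ::
  "('a::complex_hilbert \<Rightarrow>\<^sub>L 'a) \<Rightarrow> ('a \<Rightarrow>\<^sub>L 'a) \<Rightarrow> bool" where
  "op_le A B \<longleftrightarrow> op_nonneg (B - A)"

definition coercive_op :: "('a::complex_hilbert \<Rightarrow>\<^sub>L 'a) \<Rightarrow> bool" where
  "coercive_op A \<longleftrightarrow> (\<exists>\<kappa>>0. op_le (\<kappa> *\<^sub>R id_blinfun) A)"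


subsection \<open>Cayley transform and its inverse\<close>

definition cayley :: "('a::complex_hilbert \<Rightarrow>\<^sub>L 'a) \<Rightarrow> 'a \<Rightarrow>\<^sub>L 'a" where
  "cayley A = (id_blinfun + A) o\<^sub>L op_inverse (id_blinfun - A)"

definition inv_cayley :: "('a::complex_hilbert \<Rightarrow>\<^sub>L 'a) \<Rightarrow> 'a \<Rightarrow>\<^sub>L 'a" where
  "inv_cayley A = (A - id_blinfun) o\<^sub>L op_inverse (A + id_blinfun)"


subsection \<open>Exponential stability\<close>

text \<open>Stability of the zero solution of \<open>x' = A x\<close>, respectively of \<open>x\<^sub>k\<^sub>+\<^sub>1 = A x\<^sub>k\<close>.\<close>

definition exp_stable_continuous :: "('a::banach \<Rightarrow>\<^sub>L 'a) \<Rightarrow> bool" where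
  "exp_stable_continuous A \<longleftrightarrow> (\<exists>C\<ge>1. \<exists>\<omega>>0. \<forall>x0. \<forall>t\<ge>0.
     norm (blinfun_apply (op_exp (t *\<^sub>R A)) x0) \<le> C * exp (- \<omega> * t) * norm x0)"

definition exp_stable_discrete :: "('a::real_normed_vector \<Rightarrow>\<^sub>L 'a) \<Rightarrow> bool" where
  "exp_stable_discrete A \<longleftrightarrow> (\<exists>C\<ge>1. \<exists>q. 0 < q \<and> q < 1 \<and> (\<forall>x0. \<forall>k.
     norm (blinfun_apply (op_pow A k) x0) \<le> C * q ^ k * norm x0))"


subsection \<open>Hypocoercivity and hypocontractivity index\<close>

definition hermitian_part :: "('a::complex_hilbert \<Rightarrow>\<^sub>L 'a) \<Rightarrow> 'a \<Rightarrow>\<^sub>L 'a" where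
  "hermitian_part B = (B + op_adjoint B) /\<^sub>R 2"

definition hypocoercivity_sum :: "('a::complex_hilbert \<Rightarrow>\<^sub>L 'a) \<Rightarrow> nat \<Rightarrow> 'a \<Rightarrow>\<^sub>L 'a" where
  "hypocoercivity_sum B m =
     (\<Sum>j\<le>m. op_pow (op_adjoint B) j o\<^sub>L hermitian_part B o\<^sub>L op_pow B j)"

definition has_hypocoercivity_index :: "('a::complex_hilbert \<Rightarrow>\<^sub>L 'a) \<Rightarrow> nat \<Rightarrow> bool" where
  "has_hypocoercivity_index B m \<longleftrightarrow> op_nonneg (hermitian_part B) \<and>
     coercive_op (hypocoercivity_sum B m) \<and> (\<forall>k<m. \<not> coercive_op (hypocoercivity_sum B k))"

definition hypocontractivity_sum :: "('a::complex_hilbert \<Rightarrow>\<^sub>L 'a) \<Rightarrow> nat \<Rightarrow> 'a \<Rightarrow>\<^sub>L 'a" where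
  "hypocontractivity_sum B m =
     (\<Sum>j\<le>m. op_pow (op_adjoint B) j o\<^sub>L (id_blinfun - (op_adjoint B o\<^sub>L B)) o\<^sub>L op_pow B j)"

definition has_hypocontractivity_index :: "('a::complex_hilbert \<Rightarrow>\<^sub>L 'a) \<Rightarrow> nat \<Rightarrow> bool" where
  "has_hypocontractivity_index B m \<longleftrightarrow> norm B \<le> 1 \<and>
     coercive_op (hypocontractivity_sum B m) \<and>
     (\<forall>k<m. \<not> coercive_op (hypocontractivity_sum B k))"

end

theory Submission
  imports Defs
begin

text \<open>
  Write \<open>B\<close> for the continuous-time and \<open>D\<close> for the discrete-time operator. Both halves of the
  theorem concern the same symmetric situation: \<open>I + B\<close> is invertible with inverse \<open>P\<close>, and
  \<open>D (I + B) = I - B\<close>; this is the locale \<open>cayley_pair\<close>. Everything rests on the identity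
  \<open>\<parallel>x\<parallel>\<^sup>2 - \<parallel>D x\<parallel>\<^sup>2 = 4 q (P x)\<close> with \<open>q y = Re \<langle>B y, y\<rangle>\<close>: the energy lost in one discrete step is
  the dissipation of the continuous system, read off at \<open>P x\<close>. In particular \<open>D\<close> is a contraction
  exactly when \<open>B\<close> is accretive.

  Equality of the indices. Because \<open>P\<close> commutes with \<open>D\<close>, the two index sums are, up to the factor
  4 and invertible changes of the vector, \<open>\<Sum>j\<le>m. q (B\<^sup>j w)\<close> and \<open>\<Sum>j\<le>m. q (D\<^sup>j y)\<close>. Put
  \<open>y = (I + B)\<^sup>m w\<close>. Then \<open>D\<^sup>j y = (I - B)\<^sup>j (I + B)\<^sup>m\<^sup>-\<^sup>j w\<close>, so one sum tests \<open>q\<close> on the products of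
  degree \<open>m\<close> in the letters \<open>I - B, I + B\<close>, and the other on those in the letters \<open>B, I\<close>. Each
  pair of letters consists of linear combinations of the other pair, so each sum is bounded by a
  multiple of the other. Hence for every \<open>m\<close> one is coercive if and only if the other is
  (\<open>coercive_sums_iff\<close>), and the least such \<open>m\<close> agree.

  Stability. If the hypocontractivity sum up to \<open>m\<close> is coercive, its telescoping shows that
  \<open>D\<^sup>m\<^sup>+\<^sup>1\<close> is a strict contraction, which gives discrete stability
  (\<open>exp_stable_discrete_if_defect_coercive\<close>). In the other direction, if \<open>D\<close> is exponentially stable, choose
  \<open>N\<close> with \<open>\<parallel>D\<^sup>N x\<parallel>\<^sup>2 \<le> \<parallel>x\<parallel>\<^sup>2 / 2\<close>. The function \<open>v x = \<Sum>k<N. \<parallel>D\<^sup>k x\<parallel>\<^sup>2\<close> decreases strictly along \<open>D\<close>, and by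
  polarization the same inequality, read at \<open>x + B x\<close>, says that \<open>v\<close> decays at an exponential rate
  along \<open>x' = -B x\<close> (\<open>exp_stable_continuous_if_discrete\<close>).
\<close>

section \<open>Adjoints of bounded operators\<close>

text \<open>
  The representing vector is the minimizer of \<open>\<parallel>x\<parallel>\<^sup>2 - 2 f x\<close>. By the parallelogram law every
  minimizing sequence is Cauchy, and stationarity at the minimizer \<open>u\<close> reads \<open>f y = \<langle>u, y\<rangle>\<close>.
\<close>

lemma riesz_representation:
  fixes f :: "'a::{real_inner,complete_space} \<Rightarrow> real"
  assumes "bounded_linear f"
  shows "\<exists>u. \<forall>y. f y = inner u y"
proof -
  interpret f: bounded_linear f by fact
  define J where "J x = (norm x)\<^sup>2 - 2 * f x" for x
  obtain K where K: "\<And>x. norm (f x) \<le> norm x * K"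
    using f.bounded by blast
  have lower: "- K\<^sup>2 \<le> J x" for x
  proof -
    have "0 \<le> (norm x - K)\<^sup>2" by simp
    moreover have "f x \<le> norm x * K" using K[of x] by simp
    ultimately show ?thesis by (simp add: J_def power2_diff)
  qed
  define d where "d = Inf (range J)"
  have bdd: "bdd_below (range J)" using lower by (auto intro!: bdd_belowI)
  have d_le: "d \<le> J x" for x unfolding d_def by (rule cInf_lower[OF _ bdd]) simp
  have "\<exists>x. J x < d + 1 / Suc n" for n
  proof -
    have "Inf (range J) < d + 1 / Suc n" by (simp add: d_def)
    from cInf_lessD[OF _ this] show ?thesis by auto
  qed
  then obtain X where X: "\<And>n. J (X n) < d + 1 / Suc n" by metis
  have para: "(norm (x - y))\<^sup>2 \<le> 2 * (J x - d) + 2 * (J y - d)" for x y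
  proof -
    have "(norm (x - y))\<^sup>2 = 2 * J x + 2 * J y - 4 * J ((1/2) *\<^sub>R (x + y))"
      unfolding J_def power2_norm_eq_inner f.scaleR f.add
      by (simp add: algebra_simps inner_commute)
    with d_le[of "(1/2) *\<^sub>R (x + y)"] show ?thesis by simp
  qed
  have "Cauchy X"
  proof (rule metric_CauchyI)
    fix e :: real assume "0 < e"
    then have "0 < e\<^sup>2 / 4" by simp
    then obtain M :: nat where M: "inverse (Suc M) < e\<^sup>2 / 4"
      using reals_Archimedean by blast
    have small: "J (X n) - d < e\<^sup>2 / 4" if "M \<le> n" for n
    proof -
      have "1 / Suc n \<le> inverse (Suc M)" using that by (simp add: field_simps)
      with X[of n] M show ?thesis by linarith
    qed
    have "dist (X m) (X n) < e" if "M \<le> m" "M \<le> n" for m n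
    proof -
      have "(norm (X m - X n))\<^sup>2 \<le> 2 * (J (X m) - d) + 2 * (J (X n) - d)"
        by (rule para)
      also have "\<dots> < 2 * (e\<^sup>2 / 4) + 2 * (e\<^sup>2 / 4)"
        by (intro add_strict_mono mult_strict_left_mono small that) simp_all
      finally have "(norm (X m - X n))\<^sup>2 < e\<^sup>2" by simp
      then show ?thesis using \<open>0 < e\<close> by (simp add: dist_norm power2_less_imp_less[of _ e])
    qed
    then show "\<exists>M. \<forall>m\<ge>M. \<forall>n\<ge>M. dist (X m) (X n) < e" by blast
  qed
  then obtain u where u: "X \<longlonglongrightarrow> u" using Cauchy_convergent convergentD by blast
  have "(\<lambda>n. J (X n)) \<longlonglongrightarrow> J u"
    unfolding J_def by (intro tendsto_intros f.tendsto u)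
  moreover have "(\<lambda>n. d + 1 / Suc n) \<longlonglongrightarrow> d + 0"
    by (intro tendsto_intros LIMSEQ_Suc[OF lim_1_over_n])
  ultimately have "J u \<le> d"
    using LIMSEQ_le[of "\<lambda>n. J (X n)" "J u" "\<lambda>n. d + 1 / Suc n" d] X
    by (auto intro: less_imp_le)
  with d_le have min: "J u \<le> J x" for x using order_trans by blast
  have "f y = inner u y" for y
  proof (rule ccontr)
    assume ne: "f y \<noteq> inner u y"
    define a where "a = f y - inner u y"
    \<comment> \<open>the minimizer of the quadratic polynomial in \<open>t\<close> below, up to a harmless \<open>+1\<close> that covers \<open>y = 0\<close>\<close>
    define t where "t = a / ((norm y)\<^sup>2 + 1)"
    have pos: "0 < (norm y)\<^sup>2 + 1" by (simp add: add_nonneg_pos)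
    have ta: "t * ((norm y)\<^sup>2 + 1) = a" using pos by (simp add: t_def)
    have "J (u + t *\<^sub>R y) - J u = t\<^sup>2 * (norm y)\<^sup>2 - 2 * t * a"
      unfolding J_def a_def power2_norm_eq_inner f.scaleR f.add
      by (simp add: algebra_simps inner_commute power2_eq_square)
    also have "\<dots> = t\<^sup>2 * (norm y)\<^sup>2 - 2 * t * (t * ((norm y)\<^sup>2 + 1))" by (simp add: ta)
    also have "\<dots> = - (t\<^sup>2 * ((norm y)\<^sup>2 + 2))" by (simp add: algebra_simps power2_eq_square)
    also have "\<dots> < 0"
    proof -
      have "t \<noteq> 0" using ne pos by (simp add: t_def a_def)
      then have "0 < t\<^sup>2" by simp
      moreover have "0 < (norm y)\<^sup>2 + 2" by (simp add: add_nonneg_pos)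
      ultimately show ?thesis by (simp add: mult_pos_pos)
    qed
    finally show False using min[of "u + t *\<^sub>R y"] by linarith
  qed
  then show ?thesis by blast
qed

lemma cinner_eq: "cinner x y = Complex (inner x y) (- inner (\<i> *\<^sub>C x) y)"
  for x y :: "'a::complex_hilbert"
  by (simp add: complex_eq_iff Re_cinner[symmetric] cinner_scaleC_left)

lemma cinner_eqI:
  fixes u v :: "'a::complex_hilbert"
  assumes "\<And>x. cinner x u = cinner x v"
  shows "u = v"
proof -
  have "inner x (u - v) = 0" for x
    using arg_cong[OF assms[of x], of Re] by (simp add: Re_cinner inner_diff_right)
  from this[of "u - v"] show ?thesis by simp
qed

lemma cinner_scaleC_right: "cinner x (c *\<^sub>C y) = cnj c * cinner x y"
  for x y :: "'a::complex_hilbert"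
  by (metis cinner_commute cinner_scaleC_left complex_cnj_mult)

lemma adjoint_exists:
  fixes A :: "'a::complex_hilbert \<Rightarrow>\<^sub>L 'a"
  assumes "A \<in> bounded_ops"
  shows "\<exists>B\<in>bounded_ops. \<forall>x y. cinner (blinfun_apply A x) y = cinner x (blinfun_apply B y)"
proof -
  have "\<forall>y. \<exists>u. \<forall>x. inner (A x) y = inner u x"
  proof
    fix y
    have "bounded_linear (\<lambda>x. inner (A x) y)"
      by (rule bounded_linear_compose[OF bounded_linear_inner_left blinfun.bounded_linear_right])
    then show "\<exists>u. \<forall>x. inner (A x) y = inner u x" by (rule riesz_representation)
  qed
  then have "\<exists>g. \<forall>y x. inner (A x) y = inner (g y) x" by (rule choice)
  then obtain g where g: "\<And>x y. inner (A x) y = inner (g y) x" by blast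
  have g': "inner (A x) y = inner x (g y)" for x y using g by (simp add: inner_commute)
  have cg: "cinner (A x) y = cinner x (g y)" for x y
    using assms unfolding cinner_eq bounded_ops_def by (simp flip: g')
  have "bounded_linear g"
  proof (rule bounded_linear_intro[where K = "norm A"])
    show "g (x + y) = g x + g y" for x y
      by (rule vector_eq_rdot[THEN iffD1, OF allI]) (simp add: inner_add_left g[symmetric] inner_add_right)
    show "g (r *\<^sub>R x) = r *\<^sub>R g x" for r x
      by (rule vector_eq_rdot[THEN iffD1, OF allI]) (simp add: g[symmetric])
    fix y
    have "norm (g y) * norm (g y) = inner (A (g y)) y" by (simp add: g norm_eq_sqrt_inner)
    also have "\<dots> \<le> norm (A (g y)) * norm y" by (rule norm_cauchy_schwarz)
    also have "\<dots> \<le> norm A * norm (g y) * norm y"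
      by (intro mult_right_mono norm_blinfun) simp
    finally have "norm (g y) * norm (g y) \<le> norm (g y) * (norm y * norm A)"
      by (simp add: mult_ac)
    then show "norm (g y) \<le> norm y * norm A"
      by (cases "g y = 0") auto
  qed
  then have app: "blinfun_apply (Blinfun g) = g" by (rule bounded_linear_Blinfun_apply)
  have "g (c *\<^sub>C y) = c *\<^sub>C g y" for c y
    by (rule cinner_eqI) (simp add: cg[symmetric] cinner_scaleC_right)
  then show ?thesis
    using cg by (intro bexI[of _ "Blinfun g"]) (auto simp: app bounded_ops_def)
qed

text \<open>
  The form in which the adjoint enters the index sums; it rests on existence and uniqueness of the
  operator that the definite description in \<open>op_adjoint\<close> selects.
\<close>

lemma cinner_adjoint:
  fixes A :: "'a::complex_hilbert \<Rightarrow>\<^sub>L 'a"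
  assumes "A \<in> bounded_ops"
  shows "cinner (blinfun_apply (op_adjoint A) x) y = cinner x (blinfun_apply A y)"
proof -
  have "\<exists>!B. B \<in> bounded_ops \<and> (\<forall>x y. cinner (A x) y = cinner x (blinfun_apply B y))"
  proof (rule ex_ex1I)
    show "\<exists>B. B \<in> bounded_ops \<and> (\<forall>x y. cinner (A x) y = cinner x (blinfun_apply B y))"
      using adjoint_exists[OF assms] by blast
    fix B C :: "'a \<Rightarrow>\<^sub>L 'a"
    assume B: "B \<in> bounded_ops \<and> (\<forall>x y. cinner (A x) y = cinner x (blinfun_apply B y))"
      and C: "C \<in> bounded_ops \<and> (\<forall>x y. cinner (A x) y = cinner x (blinfun_apply C y))"
    have "cinner x (B y) = cinner x (C y)" for x y
      using conjunct2[OF B, rule_format, of x y] conjunct2[OF C, rule_format, of x y]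
      by (rule trans[OF sym])
    then show "B = C" by (intro blinfun_eqI cinner_eqI)
  qed
  from theI'[OF this] have *: "cinner (A y) x = cinner y (op_adjoint A x)"
    unfolding op_adjoint_def by blast
  show ?thesis
    unfolding cinner_commute[of "op_adjoint A x" y] cinner_commute[of x "A y"] * ..
qed

section \<open>Quadratic forms of the index sums\<close>

lemma op_pow_apply: "blinfun_apply (op_pow A n) x = (blinfun_apply A ^^ n) x"
  by (induction n) simp_all

lemma cinner_op_pow_adjoint:
  fixes A :: "'a::complex_hilbert \<Rightarrow>\<^sub>L 'a"
  assumes "A \<in> bounded_ops"
  shows "cinner (blinfun_apply (op_pow (op_adjoint A) j) x) y =
    cinner x ((blinfun_apply A ^^ j) y)"
  by (induction j arbitrary: y)
     (simp_all add: cinner_adjoint[OF assms] funpow_swap1)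

lemma cinner_sum_left: "cinner (\<Sum>i\<in>I. f i) y = (\<Sum>i\<in>I. cinner (f i) y)"
  for y :: "'a::complex_hilbert"
proof -
  have "cinner 0 y = 0" using cinner_add_left[of 0 0 y] by simp
  then show ?thesis by (induction I rule: infinite_finite_induct) (simp_all add: cinner_add_left)
qed

lemma cinner_diff_left: "cinner (x - z) y = cinner x y - cinner z y"
  for y :: "'a::complex_hilbert"
  using cinner_add_left[of "x - z" z y] by simp

lemma cinner_scaleR_left: "cinner (r *\<^sub>R x) y = of_real r * cinner x y"
  for x :: "'a::complex_hilbert"
  by (simp add: scaleC_of_real[symmetric] cinner_scaleC_left)

lemma cinner_self: "cinner x x = of_real ((norm x)\<^sup>2)" for x :: "'a::complex_hilbert"
proof -
  have "Im (cinner x x) = 0" using cinner_commute[of x x] by (simp add: complex_eq_iff)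
  then show ?thesis by (simp add: complex_eq_iff Re_cinner power2_norm_eq_inner)
qed

lemma cinner_hermitian_part:
  fixes B :: "'a::complex_hilbert \<Rightarrow>\<^sub>L 'a"
  assumes "B \<in> bounded_ops"
  shows "cinner (blinfun_apply (hermitian_part B) x) x = of_real (inner (blinfun_apply B x) x)"
proof -
  have "cinner (hermitian_part B x) x = (1/2) * (cinner (B x) x + cinner x (B x))"
    by (simp add: hermitian_part_def blinfun.add_left blinfun.scaleR_left cinner_scaleR_left
        cinner_add_left cinner_adjoint[OF assms])
  also have "\<dots> = of_real (Re (cinner (B x) x))"
    using cinner_commute[of x "B x"] by (simp add: complex_add_cnj)
  finally show ?thesis by (simp add: Re_cinner)
qed

lemma cinner_defect:
  fixes B :: "'a::complex_hilbert \<Rightarrow>\<^sub>L 'a"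
  assumes "B \<in> bounded_ops"
  shows "cinner (blinfun_apply (id_blinfun - (op_adjoint B o\<^sub>L B)) x) x =
    of_real ((norm x)\<^sup>2 - (norm (blinfun_apply B x))\<^sup>2)"
  by (simp add: blinfun.diff_left cinner_diff_left cinner_adjoint[OF assms] cinner_self)

text \<open>
  All operators whose coercivity matters have real quadratic forms, so that coercivity becomes an
  inequality between real functions and the complex structure can be left behind from here on.
\<close>

lemma coercive_op_iff:
  assumes "\<And>x. cinner (blinfun_apply A x) x = of_real (Q x)"
  shows "coercive_op A \<longleftrightarrow> (\<exists>\<kappa>>0. \<forall>x. \<kappa> * (norm x)\<^sup>2 \<le> Q x)"
proof -
  have "cinner (blinfun_apply (A - \<kappa> *\<^sub>R id_blinfun) x) x = of_real (Q x - \<kappa> * (norm x)\<^sup>2)" for \<kappa> x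
    by (simp add: blinfun.diff_left blinfun.scaleR_left cinner_diff_left assms
        cinner_scaleR_left cinner_self)
  then show ?thesis
    unfolding coercive_op_def op_le_def op_nonneg_def by (simp only: nonneg_Reals_of_real_iff) simp
qed

lemma coercive_hypocoercivity_sum_iff:
  fixes B :: "'a::complex_hilbert \<Rightarrow>\<^sub>L 'a"
  assumes "B \<in> bounded_ops"
  shows "coercive_op (hypocoercivity_sum B m) \<longleftrightarrow>
    (\<exists>\<kappa>>0. \<forall>x. \<kappa> * (norm x)\<^sup>2 \<le>
      (\<Sum>j\<le>m. inner (B ((blinfun_apply B ^^ j) x)) ((blinfun_apply B ^^ j) x)))"
  by (rule coercive_op_iff)
     (simp add: hypocoercivity_sum_def blinfun.sum_left cinner_sum_left op_pow_apply[of B]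
       cinner_op_pow_adjoint[OF assms] cinner_hermitian_part[OF assms])

lemma coercive_hypocontractivity_sum_iff:
  fixes B :: "'a::complex_hilbert \<Rightarrow>\<^sub>L 'a"
  assumes "B \<in> bounded_ops"
  shows "coercive_op (hypocontractivity_sum B m) \<longleftrightarrow>
    (\<exists>\<kappa>>0. \<forall>x. \<kappa> * (norm x)\<^sup>2 \<le>
      (\<Sum>j\<le>m. (norm ((blinfun_apply B ^^ j) x))\<^sup>2 - (norm ((blinfun_apply B ^^ Suc j) x))\<^sup>2))"
proof (rule coercive_op_iff)
  fix x
  have "cinner (hypocontractivity_sum B m x) x =
    (\<Sum>j\<le>m. cinner (blinfun_apply (id_blinfun - (op_adjoint B o\<^sub>L B)) ((blinfun_apply B ^^ j) x))
      ((blinfun_apply B ^^ j) x))"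
    unfolding hypocontractivity_sum_def blinfun.sum_left cinner_sum_left blinfun_apply_blinfun_compose
      op_pow_apply[of B] cinner_op_pow_adjoint[OF assms] ..
  then show "cinner (hypocontractivity_sum B m x) x = of_real (\<Sum>j\<le>m.
      (norm ((blinfun_apply B ^^ j) x))\<^sup>2 - (norm ((blinfun_apply B ^^ Suc j) x))\<^sup>2)"
    by (simp add: cinner_defect[OF assms] del: of_real_diff)
qed

section \<open>Words in two operators\<close>

text \<open>
  The parallelogram law characterizes quadratic forms without mentioning their polar form; the class
  is visibly closed under sums and under composition with linear maps.
\<close>

definition nonneg_quadratic_form :: "('a::real_vector \<Rightarrow> real) \<Rightarrow> bool" where
  "nonneg_quadratic_form q \<longleftrightarrow> (\<forall>x. 0 \<le> q x) \<and> (\<forall>c x. q (c *\<^sub>R x) = c\<^sup>2 * q x) \<and>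
     (\<forall>x y. q (x + y) + q (x - y) = 2 * q x + 2 * q y)"

text \<open>
  The sum of \<open>q (w x)\<close> over all \<open>2\<^sup>n\<close> words \<open>w\<close> of length \<open>n\<close> in the letters \<open>a\<close> and \<open>b\<close>. For commuting
  letters this is \<open>\<Sum>j\<le>n. (n choose j) q (a\<^sup>j b\<^sup>n\<^sup>-\<^sup>j x)\<close>; summing over words keeps the recursion
  free of binomial coefficients.
\<close>

primrec word_form :: "('a \<Rightarrow> real) \<Rightarrow> ('a \<Rightarrow> 'a) \<Rightarrow> ('a \<Rightarrow> 'a) \<Rightarrow> nat \<Rightarrow> 'a \<Rightarrow> real" where
  "word_form q a b 0 x = q x"
| "word_form q a b (Suc n) x = word_form q a b n (a x) + word_form q a b n (b x)"

lemma nonneg_quadratic_form_word_form: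
  assumes "nonneg_quadratic_form q" "linear a" "linear b"
  shows "nonneg_quadratic_form (word_form q a b n)"
proof (induction n)
  case 0
  then show ?case using assms(1) by (simp add: nonneg_quadratic_form_def)
next
  case (Suc n)
  then show ?case
    unfolding nonneg_quadratic_form_def
    by (simp add: linear_add[OF assms(2)] linear_add[OF assms(3)] linear_diff[OF assms(2)]
        linear_diff[OF assms(3)] linear_scale[OF assms(2)] linear_scale[OF assms(3)] algebra_simps)
qed

lemma nonneg_quadratic_form_combination:
  assumes "nonneg_quadratic_form q"
  shows "q (\<alpha> *\<^sub>R x + \<beta> *\<^sub>R y) \<le> 2 * \<alpha>\<^sup>2 * q x + 2 * \<beta>\<^sup>2 * q y"
proof -
  have "q (\<alpha> *\<^sub>R x + \<beta> *\<^sub>R y) + q (\<alpha> *\<^sub>R x - \<beta> *\<^sub>R y) = 2 * q (\<alpha> *\<^sub>R x) + 2 * q (\<beta> *\<^sub>R y)"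
    and "0 \<le> q (\<alpha> *\<^sub>R x - \<beta> *\<^sub>R y)"
    and "q (\<alpha> *\<^sub>R x) = \<alpha>\<^sup>2 * q x" "q (\<beta> *\<^sub>R y) = \<beta>\<^sup>2 * q y"
    using assms unfolding nonneg_quadratic_form_def by blast+
  then show ?thesis by linarith
qed

text \<open>
  Each further letter costs only a constant factor, because a nonnegative quadratic form satisfies
  \<open>q (s + t) \<le> 2 q s + 2 q t\<close>. An invertible change of letters gives an estimate in both directions.
\<close>

lemma word_form_change_letters:
  fixes a b u v :: "'a::real_vector \<Rightarrow> 'a"
  assumes q: "nonneg_quadratic_form q" and lin: "linear a" "linear b"
    and u: "\<And>x. u x = \<alpha> *\<^sub>R a x + \<beta> *\<^sub>R b x"
    and v: "\<And>x. v x = \<gamma> *\<^sub>R a x + \<delta> *\<^sub>R b x"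
  shows "\<exists>C>0. \<forall>x. word_form q u v n x \<le> C * word_form q a b n x"
proof (induction n)
  case 0
  show ?case by (intro exI[of _ 1]) simp
next
  case (Suc n)
  then obtain C where "0 < C" and C: "\<And>x. word_form q u v n x \<le> C * word_form q a b n x"
    by blast
  define K where "K = 2 * (\<alpha>\<^sup>2 + \<beta>\<^sup>2 + \<gamma>\<^sup>2 + \<delta>\<^sup>2) + 1"
  let ?w = "word_form q a b n"
  have wq: "nonneg_quadratic_form ?w" by (rule nonneg_quadratic_form_word_form[OF q lin])
  then have w0: "0 \<le> ?w x" for x by (simp add: nonneg_quadratic_form_def)
  have "word_form q u v (Suc n) x \<le> C * K * word_form q a b (Suc n) x" for x
  proof -
    have "?w (u x) + ?w (v x) \<le>
        (2 * \<alpha>\<^sup>2 + 2 * \<gamma>\<^sup>2) * ?w (a x) + (2 * \<beta>\<^sup>2 + 2 * \<delta>\<^sup>2) * ?w (b x)"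
      using nonneg_quadratic_form_combination[OF wq, of \<alpha> "a x" \<beta> "b x"]
        nonneg_quadratic_form_combination[OF wq, of \<gamma> "a x" \<delta> "b x"]
      by (simp add: u v algebra_simps)
    also have "\<dots> \<le> K * ?w (a x) + K * ?w (b x)"
      by (intro add_mono mult_right_mono w0) (simp_all add: K_def)
    finally have "C * (?w (u x) + ?w (v x)) \<le> C * (K * ?w (a x) + K * ?w (b x))"
      using \<open>0 < C\<close> by simp
    then show ?thesis using C[of "u x"] C[of "v x"] by (simp add: algebra_simps)
  qed
  moreover have "0 < C * K"
  proof -
    have "0 < K" unfolding K_def by (intro add_nonneg_pos) simp_all
    with \<open>0 < C\<close> show ?thesis by simp
  qed
  ultimately show ?case by blast
qed

text \<open>
  With the identity as second letter, a word is a power \<open>a\<^sup>j\<close>, and each \<open>j \<le> n\<close> occurs at least once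
  and at most \<open>2\<^sup>n\<close> times.
\<close>

lemma word_form_id_bounds:
  assumes "\<And>x. 0 \<le> q x"
  shows "(\<Sum>j\<le>n. q ((a ^^ j) x)) \<le> word_form q a (\<lambda>x. x) n x"
    and "word_form q a (\<lambda>x. x) n x \<le> 2 ^ n * (\<Sum>j\<le>n. q ((a ^^ j) x))"
proof (induction n arbitrary: x)
  case (Suc n)
  let ?S = "\<lambda>n x. \<Sum>j\<le>n. q ((a ^^ j) x)"
  have shift: "?S (Suc n) x = q x + ?S n (a x)" for x
    by (subst sum.atMost_Suc_shift) (simp add: funpow_swap1)
  have first: "q x \<le> ?S n x" for x
    using member_le_sum[of 0 "{..n}" "\<lambda>j. q ((a ^^ j) x)"] assms by simp
  {
    case 1
    have "q x \<le> word_form q a (\<lambda>x. x) n x" using first Suc(1)[of x] by (rule order_trans)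
    from add_mono[OF this Suc(1)[of "a x"]] show ?case
      unfolding shift by (simp add: add.commute)
  next
    case 2
    have "?S n (a x) \<le> ?S (Suc n) x" using shift[of x] assms[of x] by simp
    moreover have "?S n x \<le> ?S (Suc n) x" using assms by simp
    ultimately have "2 ^ n * (?S n (a x) + ?S n x) \<le> 2 ^ n * (2 * ?S (Suc n) x)"
      by (intro mult_left_mono) simp_all
    then show ?case using Suc(2)[of "a x"] Suc(2)[of x]
      by (simp add: algebra_simps del: sum.atMost_Suc)
  }
qed simp_all

text \<open>
  The passage from \<open>D\<close> to \<open>I - B\<close> and \<open>I + B\<close>: since \<open>a = d b\<close>, each word in \<open>a, b\<close> is \<open>d\<^sup>j b\<^sup>n\<close>, where
  \<open>j\<close> counts the letters \<open>a\<close>.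
\<close>

lemma word_form_homogenize:
  assumes "\<And>x. a x = d (b x)" and "\<And>x. b (d x) = d (b x)"
  shows "word_form q a b n x = word_form q d (\<lambda>x. x) n ((b ^^ n) x)"
proof (induction n arbitrary: x)
  case (Suc n)
  have "(b ^^ n) (d y) = d ((b ^^ n) y)" for y
    by (induction n) (simp_all add: assms(2))
  then have "(b ^^ n) (a x) = d ((b ^^ Suc n) x)" by (simp add: assms(1) funpow_swap1)
  moreover have "(b ^^ n) (b x) = (b ^^ Suc n) x" by (simp add: funpow_swap1)
  ultimately show ?case by (simp only: word_form.simps Suc)
qed simp

section \<open>The operator exponential\<close>

lemma norm_op_pow_apply_le: "norm (blinfun_apply (op_pow A n) x) \<le> norm A ^ n * norm x"
proof (induction n)
  case (Suc n)
  have "norm (op_pow A (Suc n) x) \<le> norm A * norm (op_pow A n x)"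
    by (simp add: norm_blinfun)
  also have "\<dots> \<le> norm A * (norm A ^ n * norm x)" by (intro mult_left_mono Suc) simp
  finally show ?case by (simp add: mult_ac)
qed simp

lemma op_pow_scaleR: "op_pow (t *\<^sub>R A) n = t ^ n *\<^sub>R op_pow A n"
  by (induction n) (auto intro!: blinfun_eqI simp: blinfun.scaleR_left blinfun.scaleR_right)

lemma op_exp_sums:
  fixes A :: "'a::banach \<Rightarrow>\<^sub>L 'a"
  shows "(\<lambda>n. (t ^ n / fact n) *\<^sub>R blinfun_apply (op_pow A n) x) sums blinfun_apply (op_exp (t *\<^sub>R A)) x"
proof -
  have "norm (op_pow (t *\<^sub>R A) n) \<le> norm (t *\<^sub>R A) ^ n" for n
    by (rule norm_blinfun_bound) (simp_all add: norm_op_pow_apply_le del: norm_scaleR)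
  then have "summable (\<lambda>n. op_pow (t *\<^sub>R A) n /\<^sub>R fact n)"
    by (intro summable_comparison_test'[OF summable_exp_generic[of "norm (t *\<^sub>R A)"], of 0])
       (simp add: mult_left_mono norm_scaleR[of "inverse _"] del: norm_scaleR)
  then have "(\<lambda>n. op_pow (t *\<^sub>R A) n /\<^sub>R fact n) sums op_exp (t *\<^sub>R A)"
    unfolding op_exp_def by (rule summable_sums)
  from bounded_linear.sums[OF blinfun.bounded_linear_left this] show ?thesis
    by (simp add: op_pow_scaleR blinfun.scaleR_left divide_inverse_commute)
qed

lemma op_exp_zero: "blinfun_apply (op_exp (0 *\<^sub>R A)) x = x" for A :: "'a::banach \<Rightarrow>\<^sub>L 'a"
proof -
  have "(\<lambda>n. (0 ^ n / fact n) *\<^sub>R blinfun_apply (op_pow A n) x) sums x"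
    using sums_finite[of "{0}" "\<lambda>n. (0 ^ n / fact n) *\<^sub>R blinfun_apply (op_pow A n) x"] by simp
  with op_exp_sums[of 0 A x] show ?thesis by (rule sums_unique2)
qed

text \<open>
  Termwise differentiation of the exponential series along an orbit: on a bounded interval the
  series of derivatives is dominated by an exponential series of reals.
\<close>

lemma op_exp_has_vector_derivative:
  fixes A :: "'a::banach \<Rightarrow>\<^sub>L 'a"
  shows "((\<lambda>t. blinfun_apply (op_exp (t *\<^sub>R A)) x) has_vector_derivative
    blinfun_apply A (blinfun_apply (op_exp (t *\<^sub>R A)) x)) (at t)"
proof -
  define R where "R = \<bar>t\<bar> + 1"
  define S where "S = {-R<..<R}"
  have S: "open S" "convex S" "t \<in> S" by (auto simp: S_def R_def)
  define f where "f n s = (s ^ n / fact n) *\<^sub>R blinfun_apply (op_pow A n) x" for n and s :: real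
  define f' where "f' n s = (case n of 0 \<Rightarrow> 0 | Suc k \<Rightarrow> blinfun_apply A (f k s))" for n s
  define E where "E s = blinfun_apply (op_exp (s *\<^sub>R A)) x" for s
  have f_sums: "(\<lambda>n. f n s) sums E s" for s unfolding f_def E_def by (rule op_exp_sums)
  have f'_sums: "(\<lambda>n. f' n s) sums blinfun_apply A (E s)" for s
  proof -
    have "(\<lambda>n. f' (Suc n) s) sums blinfun_apply A (E s)"
      by (simp add: f'_def bounded_linear.sums[OF blinfun.bounded_linear_right f_sums])
    then have "(\<lambda>n. f' n s) sums (blinfun_apply A (E s) + f' 0 s)"
      by (rule sums_Suc)
    then show ?thesis by (simp add: f'_def)
  qed
  have deriv: "(f n has_vector_derivative f' n s) (at s within S)" for n s
  proof (cases n)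
    case 0
    then show ?thesis by (simp add: f_def[abs_def] f'_def)
  next
    case (Suc k)
    have "((\<lambda>s. s ^ Suc k / fact (Suc k)) has_real_derivative s ^ k / fact k) (at s within S)"
      using DERIV_cdivide[OF DERIV_pow[of "Suc k" s S], of "fact (Suc k)"]
      by (simp add: fact_Suc del: power_Suc of_nat_Suc)
    from has_vector_derivative_scaleR[OF this has_vector_derivative_const]
    show ?thesis
      by (simp add: Suc f_def[abs_def] f'_def blinfun.scaleR_right)
  qed
  define M where "M n = (case n of 0 \<Rightarrow> 0 | Suc k \<Rightarrow> norm A * norm x * ((R * norm A) ^ k /\<^sub>R fact k))" for n
  have "summable (\<lambda>n. M (Suc n))"
    unfolding M_def by (simp only: nat.case) (intro summable_mult summable_exp_generic)
  then have M: "summable M" by (simp only: summable_Suc_iff)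
  have bound: "norm (f' n s) \<le> M n" if "s \<in> S" for n s
  proof (cases n)
    case (Suc k)
    have s: "\<bar>s\<bar> \<le> R" using that by (auto simp: S_def)
    have "norm (f' n s) \<le> norm A * norm (f k s)"
      by (simp add: Suc f'_def norm_blinfun)
    also have "\<dots> \<le> norm A * (R ^ k / fact k * (norm A ^ k * norm x))"
      unfolding f_def norm_scaleR
      using s by (intro mult_left_mono mult_mono norm_op_pow_apply_le)
        (auto simp: power_abs intro!: divide_right_mono power_mono)
    also have "\<dots> = M n" by (simp add: Suc M_def power_mult_distrib field_simps)
    finally show ?thesis .
  qed (simp add: f'_def M_def)
  have unif: "uniform_limit S (\<lambda>n s. \<Sum>i<n. f' i s) (\<lambda>s. blinfun_apply A (E s)) sequentially"
  proof -
    have "(\<lambda>s. blinfun_apply A (E s)) = (\<lambda>s. \<Sum>i. f' i s)"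
      by (rule ext) (rule sums_unique[OF f'_sums])
    moreover have "uniform_limit S (\<lambda>n s. \<Sum>i<n. f' i s) (\<lambda>s. \<Sum>i. f' i s) sequentially"
      by (rule Weierstrass_m_test[where M = M, OF bound M])
    ultimately show ?thesis by simp
  qed
  have "\<exists>g. \<forall>s\<in>S. (\<lambda>n. f n s) sums g s \<and>
      (g has_derivative (\<lambda>h. h *\<^sub>R blinfun_apply A (E s))) (at s within S)"
  proof (rule has_derivative_series[where f = f and f' = "\<lambda>n s h. h *\<^sub>R f' n s" and x = t and l = "E t",
        OF \<open>convex S\<close> _ _ \<open>t \<in> S\<close> f_sums])
    show "(f n has_derivative (\<lambda>h. h *\<^sub>R f' n s)) (at s within S)" for n s
      using deriv by (simp add: has_vector_derivative_def)
    fix e :: real assume "0 < e"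
    with unif have "\<forall>\<^sub>F n in sequentially. \<forall>s\<in>S. dist (\<Sum>i<n. f' i s) (blinfun_apply A (E s)) < e"
      by (simp add: uniform_limit_iff)
    then show "\<forall>\<^sub>F n in sequentially. \<forall>s\<in>S. \<forall>h.
        norm ((\<Sum>i<n. h *\<^sub>R f' i s) - h *\<^sub>R blinfun_apply A (E s)) \<le> e * norm h"
    proof (rule eventually_mono, intro ballI allI)
      fix n s and h :: real
      assume "\<forall>s\<in>S. dist (\<Sum>i<n. f' i s) (blinfun_apply A (E s)) < e" "s \<in> S"
      then have "norm ((\<Sum>i<n. f' i s) - blinfun_apply A (E s)) \<le> e"
        by (simp add: dist_norm less_imp_le)
      then have "\<bar>h\<bar> * norm ((\<Sum>i<n. f' i s) - blinfun_apply A (E s)) \<le> \<bar>h\<bar> * e"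
        by (rule mult_left_mono) simp
      then show "norm ((\<Sum>i<n. h *\<^sub>R f' i s) - h *\<^sub>R blinfun_apply A (E s)) \<le> e * norm h"
        by (simp add: scaleR_sum_right[symmetric] scaleR_diff_right[symmetric] mult.commute)
    qed
  qed
  then obtain g where g: "\<And>s. s \<in> S \<Longrightarrow> (\<lambda>n. f n s) sums g s"
    "\<And>s. s \<in> S \<Longrightarrow> (g has_vector_derivative blinfun_apply A (E s)) (at s within S)"
    unfolding has_vector_derivative_def by blast
  have eq: "g s = E s" if "s \<in> S" for s
    by (rule sums_unique2[OF g(1)[OF that] f_sums[of s]])
  have "(g has_vector_derivative blinfun_apply A (E t)) (at t)"
    using g(2)[OF \<open>t \<in> S\<close>] unfolding at_within_open[OF \<open>t \<in> S\<close> \<open>open S\<close>] .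
  then have "(E has_vector_derivative blinfun_apply A (E t)) (at t)"
    by (rule has_vector_derivative_transform_within_open[OF _ \<open>open S\<close> \<open>t \<in> S\<close> eq])
  then show ?thesis by (simp add: E_def[abs_def])
qed

section \<open>Discrete stability\<close>

text \<open>
  If \<open>D\<^sup>M\<close> contracts by the factor \<open>r\<close>, the rate per step is the \<open>M\<close>-th root of \<open>r\<close>; the constant
  \<open>1 / r\<close> pays for the last, incomplete block of fewer than \<open>M\<close> steps.
\<close>

lemma exp_stable_discreteI:
  fixes D :: "'a::real_normed_vector \<Rightarrow>\<^sub>L 'a"
  assumes D: "norm D \<le> 1" and M: "0 < M" and r: "0 < r" "r < 1"
    and contr: "\<And>x. norm ((blinfun_apply D ^^ M) x) \<le> r * norm x"
  shows "exp_stable_discrete D"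
proof -
  define q where "q = root M r"
  have q: "0 < q" "q < 1" and qM: "q ^ M = r" using r M by (simp_all add: q_def)
  have mult: "norm ((blinfun_apply D ^^ (M * i)) x) \<le> r ^ i * norm x" for i x
  proof (induction i)
    case (Suc i)
    have "norm ((blinfun_apply D ^^ (M * Suc i)) x) \<le> r * norm ((blinfun_apply D ^^ (M * i)) x)"
      using contr by (simp add: funpow_add)
    also have "\<dots> \<le> r * (r ^ i * norm x)" using r by (intro mult_left_mono Suc) simp
    finally show ?case by (simp add: mult_ac)
  qed simp
  have "norm (blinfun_apply (op_pow D k) x) \<le> (1 / r) * q ^ k * norm x" for k x
  proof -
    have "norm (op_pow D k x) = norm (op_pow D (k mod M) ((blinfun_apply D ^^ (M * (k div M))) x))"
      by (simp add: op_pow_apply flip: funpow_add[THEN fun_cong, unfolded comp_def])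
    also have "\<dots> \<le> norm D ^ (k mod M) * norm ((blinfun_apply D ^^ (M * (k div M))) x)"
      by (rule norm_op_pow_apply_le)
    also have "\<dots> \<le> 1 * (r ^ (k div M) * norm x)"
      using D by (intro mult_mono mult power_le_one) auto
    also have "r ^ (k div M) \<le> (1 / r) * q ^ k"
    proof -
      have "k \<le> M * (k div M) + M"
        using M by (metis add_left_mono less_imp_le mod_less_divisor mult_div_mod_eq)
      then have "q ^ (M * (k div M) + M) \<le> q ^ k" using q by (intro power_decreasing) auto
      then show ?thesis using r by (simp add: power_add power_mult qM field_simps)
    qed
    finally show ?thesis by (simp add: mult_right_mono)
  qed
  moreover have "1 \<le> 1 / r" using r by simp
  ultimately show ?thesis unfolding exp_stable_discrete_def using q by blast
qed

lemma sum_defect_telescope: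
  fixes f :: "nat \<Rightarrow> real"
  shows "(\<Sum>j\<le>m. f j - f (Suc j)) = f 0 - f (Suc m)"
  by (induction m) simp_all

text \<open>
  The sum telescopes to \<open>\<parallel>x\<parallel>\<^sup>2 - \<parallel>D\<^sup>m\<^sup>+\<^sup>1 x\<parallel>\<^sup>2\<close>, so coercivity makes \<open>D\<^sup>m\<^sup>+\<^sup>1\<close> a strict contraction.
\<close>

lemma exp_stable_discrete_if_defect_coercive:
  fixes D :: "'a::real_normed_vector \<Rightarrow>\<^sub>L 'a"
  assumes D: "norm D \<le> 1" and "0 < \<kappa>"
    and coercive: "\<And>x. \<kappa> * (norm x)\<^sup>2 \<le>
      (\<Sum>j\<le>m. (norm ((blinfun_apply D ^^ j) x))\<^sup>2 - (norm ((blinfun_apply D ^^ Suc j) x))\<^sup>2)"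
  shows "exp_stable_discrete D"
proof (rule exp_stable_discreteI[OF D])
  \<comment> \<open>shrinking \<open>\<kappa>\<close> keeps the contraction factor \<open>sqrt (1 - \<mu>)\<close> positive even if \<open>D\<^sup>m\<^sup>+\<^sup>1 = 0\<close>\<close>
  define \<mu> where "\<mu> = min \<kappa> (1 / 2)"
  have \<mu>: "0 < \<mu>" "\<mu> < 1" "\<mu> \<le> \<kappa>" using \<open>0 < \<kappa>\<close> by (auto simp: \<mu>_def)
  show "0 < Suc m" by simp
  show "0 < sqrt (1 - \<mu>)" "sqrt (1 - \<mu>) < 1" using \<mu> by simp_all
  fix x :: 'a
  have "\<mu> * (norm x)\<^sup>2 \<le> \<kappa> * (norm x)\<^sup>2" using \<mu> by (intro mult_right_mono) simp_all
  also have "\<dots> \<le> (norm x)\<^sup>2 - (norm ((blinfun_apply D ^^ Suc m) x))\<^sup>2"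
    using coercive[of x] sum_defect_telescope[of "\<lambda>j. (norm ((blinfun_apply D ^^ j) x))\<^sup>2" m]
    by simp
  finally have "(norm ((blinfun_apply D ^^ Suc m) x))\<^sup>2 \<le> (1 - \<mu>) * (norm x)\<^sup>2"
    by (simp add: algebra_simps)
  also have "\<dots> = (sqrt (1 - \<mu>) * norm x)\<^sup>2" using \<mu> by (simp add: power_mult_distrib)
  finally show "norm ((blinfun_apply D ^^ Suc m) x) \<le> sqrt (1 - \<mu>) * norm x"
    by (rule power2_le_imp_le) (use \<mu> in simp)
qed

section \<open>Operators related by the Cayley transform\<close>

text \<open>
  Coercivity survives a change of variable by a map \<open>T\<close> that is bounded below, here a power of
  \<open>I + B\<close> or of its inverse.
\<close>

lemma coercive_transfer:
  fixes T :: "'a::real_normed_vector \<Rightarrow> 'a"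
  assumes le: "\<And>x. Q (T x) \<le> C * R x" and "0 < C"
    and expand: "\<And>x. norm x \<le> L * norm (T x)" and "0 < L"
    and Q: "\<exists>\<kappa>>0. \<forall>x. \<kappa> * (norm x)\<^sup>2 \<le> Q x"
  shows "\<exists>\<kappa>>0. \<forall>x. \<kappa> * (norm x)\<^sup>2 \<le> R x"
proof -
  obtain \<kappa> where \<kappa>: "0 < \<kappa>" "\<And>x. \<kappa> * (norm x)\<^sup>2 \<le> Q x" using Q by blast
  have "\<kappa> / (L\<^sup>2 * C) * (norm x)\<^sup>2 \<le> R x" for x
  proof -
    have "\<kappa> * (norm x)\<^sup>2 \<le> \<kappa> * (L * norm (T x))\<^sup>2"
      using \<kappa>(1) expand by (intro mult_left_mono power_mono) simp_all
    also have "\<dots> = L\<^sup>2 * (\<kappa> * (norm (T x))\<^sup>2)" by (simp add: power_mult_distrib)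
    also have "\<dots> \<le> L\<^sup>2 * (C * R x)"
      by (intro mult_left_mono order_trans[OF \<kappa>(2) le]) simp
    finally show ?thesis using \<open>0 < L\<close> \<open>0 < C\<close> by (simp add: field_simps)
  qed
  moreover have "0 < \<kappa> / (L\<^sup>2 * C)" using \<kappa>(1) \<open>0 < L\<close> \<open>0 < C\<close> by simp
  ultimately show ?thesis by blast
qed

text \<open>
  The relation between \<open>B\<close> and its Cayley transform \<open>D = (I - B)(I + B)\<^sup>-\<^sup>1\<close>, stated pointwise and
  over the reals. It also holds when \<open>D\<close> is given and \<open>B = (I - D)(I + D)\<^sup>-\<^sup>1\<close>, with
  \<open>P = (I + D) / 2\<close>, so one argument covers both directions.
\<close>

locale cayley_pair =
  fixes B D P :: "'a::{real_inner,banach} \<Rightarrow>\<^sub>L 'a"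
  assumes inverse_left: "blinfun_apply P (x + blinfun_apply B x) = x"
    and inverse_right: "blinfun_apply P x + blinfun_apply B (blinfun_apply P x) = x"
    and D_apply: "blinfun_apply D (x + blinfun_apply B x) = x - blinfun_apply B x"
begin

lemma D_commutes_P: "blinfun_apply P (blinfun_apply D x) = blinfun_apply D (blinfun_apply P x)"
proof -
  define z where "z = P (P x)"
  have y: "P x = z + B z" using inverse_right[of "P x"] by (simp add: z_def)
  have "D x = P x - B (P x)" using D_apply[of "P x"] by (simp add: inverse_right)
  also have "\<dots> = (z - B z) + B (z - B z)"
    unfolding y by (simp add: blinfun.add_right blinfun.diff_right)
  finally have "P (D x) = z - B z" by (simp add: inverse_left)
  then show ?thesis by (simp add: y D_apply)
qed

text \<open>
  Polarization: for \<open>y = P x\<close> the vectors \<open>x\<close> and \<open>D x\<close> are \<open>y + B y\<close> and \<open>y - B y\<close>.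
\<close>

lemma defect: "(norm x)\<^sup>2 - (norm (blinfun_apply D x))\<^sup>2 =
  4 * inner (blinfun_apply B (blinfun_apply P x)) (blinfun_apply P x)"
proof -
  define y where "y = P x"
  have x: "x = y + B y" by (simp add: y_def inverse_right)
  have "(norm (y + B y))\<^sup>2 - (norm (y - B y))\<^sup>2 = 4 * inner (B y) y"
    by (simp add: power2_norm_eq_inner algebra_simps inner_commute)
  then show ?thesis unfolding y_def[symmetric] by (simp add: x D_apply)
qed

lemma contraction_iff_accretive:
  "norm D \<le> 1 \<longleftrightarrow> (\<forall>x. 0 \<le> inner (blinfun_apply B x) x)"
proof
  assume D: "norm D \<le> 1"
  show "\<forall>x. 0 \<le> inner (B x) x"
  proof
    fix x
    have "norm (D (x + B x)) \<le> norm D * norm (x + B x)" by (rule norm_blinfun)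
    also have "\<dots> \<le> norm (x + B x)" using D by (simp add: mult_left_le_one_le)
    finally have "(norm (D (x + B x)))\<^sup>2 \<le> (norm (x + B x))\<^sup>2" by (intro power_mono) simp_all
    then show "0 \<le> inner (B x) x" using defect[of "x + B x"] unfolding inverse_left by linarith
  qed
next
  assume acc: "\<forall>x. 0 \<le> inner (B x) x"
  show "norm D \<le> 1"
  proof (rule norm_blinfun_bound)
    fix x
    have "(norm (D x))\<^sup>2 \<le> (norm x)\<^sup>2" using defect[of x] acc by (smt (verit))
    then show "norm (D x) \<le> 1 * norm x" by simp
  qed simp
qed

lemma defect_sum:
  "(\<Sum>j\<le>m. (norm ((blinfun_apply D ^^ j) x))\<^sup>2 - (norm ((blinfun_apply D ^^ Suc j) x))\<^sup>2) =
    4 * (\<Sum>j\<le>m. inner (blinfun_apply B ((blinfun_apply D ^^ j) (blinfun_apply P x)))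
      ((blinfun_apply D ^^ j) (blinfun_apply P x)))"
proof -
  have "P ((blinfun_apply D ^^ j) x) = (blinfun_apply D ^^ j) (P x)" for j
    by (induction j) (simp_all add: D_commutes_P)
  then show ?thesis by (simp add: defect sum_distrib_left)
qed

lemma shift_pow_inverse:
  "(blinfun_apply (id_blinfun + B) ^^ n) ((blinfun_apply P ^^ n) x) = x"
  "(blinfun_apply P ^^ n) ((blinfun_apply (id_blinfun + B) ^^ n) x) = x"
proof (induction n arbitrary: x)
  case (Suc n)
  {
    case 1
    show ?case
      using Suc(1)[of "P x"] by (simp add: funpow_swap1 blinfun.add_left inverse_right)
  next
    case 2
    have "P ((id_blinfun + B) y) = y" for y by (simp add: blinfun.add_left inverse_left)
    then show ?case
      using Suc(2)[of x]
      unfolding funpow_Suc_right[where f = "blinfun_apply P"]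
        funpow.simps(2)[where f = "blinfun_apply (id_blinfun + B)"]
      by simp
  }
qed simp_all

text \<open>
  The common measure of the two sums is the word form in \<open>a = I - B\<close> and \<open>b = I + B\<close>. Homogenization
  identifies it with the word form in \<open>D, I\<close> at \<open>b\<^sup>m w\<close>, and the change of letters
  \<open>B = (b - a) / 2\<close>, \<open>I = (a + b) / 2\<close> compares it with the one in \<open>B, I\<close> at \<open>w\<close>.
\<close>

lemma coercive_sums_iff:
  assumes accretive: "\<And>x. 0 \<le> inner (blinfun_apply B x) x"
  shows "(\<exists>\<kappa>>0. \<forall>x. \<kappa> * (norm x)\<^sup>2 \<le>
      (\<Sum>j\<le>m. inner (blinfun_apply B ((blinfun_apply B ^^ j) x)) ((blinfun_apply B ^^ j) x))) \<longleftrightarrow>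
    (\<exists>\<kappa>>0. \<forall>x. \<kappa> * (norm x)\<^sup>2 \<le>
      (\<Sum>j\<le>m. (norm ((blinfun_apply D ^^ j) x))\<^sup>2 - (norm ((blinfun_apply D ^^ Suc j) x))\<^sup>2))"
    (is "(\<exists>\<kappa>>0. \<forall>x. \<kappa> * (norm x)\<^sup>2 \<le> ?c x) \<longleftrightarrow> (\<exists>\<kappa>>0. \<forall>x. \<kappa> * (norm x)\<^sup>2 \<le> ?d x)")
proof -
  define q where "q x = inner (B x) x" for x
  define b where "b = id_blinfun + B"
  define a where "a = id_blinfun - B"
  have q0: "0 \<le> q x" for x using accretive by (simp add: q_def)
  have q: "nonneg_quadratic_form q"
    unfolding nonneg_quadratic_form_def
    by (auto simp: q0) (simp_all add: q_def blinfun.add_right blinfun.diff_right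
        blinfun.scaleR_right algebra_simps inner_simps power2_eq_square)
  have lin: "linear (blinfun_apply T)" for T :: "'a \<Rightarrow>\<^sub>L 'a"
    by (intro bounded_linear.linear blinfun.bounded_linear_right)
  have lin_id: "linear (\<lambda>x::'a. x)" by (rule linear_ident)
  let ?d' = "\<lambda>x. \<Sum>j\<le>m. q ((blinfun_apply D ^^ j) x)"
  let ?wB = "word_form q (blinfun_apply B) (\<lambda>x. x) m"
  let ?wD = "word_form q (blinfun_apply D) (\<lambda>x. x) m"
  let ?w = "word_form q (blinfun_apply a) (blinfun_apply b) m"
  have c: "?c x = (\<Sum>j\<le>m. q ((blinfun_apply B ^^ j) x))" for x by (simp add: q_def)
  have d: "?d x = 4 * ?d' (P x)" for x by (simp only: defect_sum q_def)
  have hom: "?w x = ?wD ((blinfun_apply b ^^ m) x)" for x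
  proof (rule word_form_homogenize)
    show ab: "a x = D (b x)" for x
      by (simp add: a_def b_def blinfun.add_left blinfun.diff_left D_apply)
    fix x
    have x: "P x + B (P x) = x" by (rule inverse_right)
    have Dx: "D x = P x - B (P x)" using D_apply[of "P x"] by (simp add: inverse_right)
    have Bx: "B x = B (P x) + B (B (P x))" using arg_cong[OF x, of B] by (simp add: blinfun.add_right)
    have "b (D x) = P x - B (B (P x))"
      by (simp add: b_def Dx blinfun.add_left blinfun.diff_right)
    also have "\<dots> = (P x + B (P x)) - B x" by (simp add: Bx)
    also have "\<dots> = D (b x)" unfolding x ab[symmetric] by (simp add: a_def blinfun.diff_left)
    finally show "b (D x) = D (b x)" .
  qed
  obtain C where C: "0 < C" "\<And>x. ?w x \<le> C * ?wB x"
    using word_form_change_letters[OF q lin lin_id, of "blinfun_apply a" "-1" B 1 "blinfun_apply b" 1 1 m]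
    by (auto simp: a_def b_def blinfun.add_left blinfun.diff_left add.commute)
  obtain C' where C': "0 < C'" "\<And>x. ?wB x \<le> C' * ?w x"
    using word_form_change_letters[OF q lin lin, of "blinfun_apply B" "- 1 / 2" a "1 / 2" b
        "\<lambda>x. x" "1 / 2" "1 / 2" m]
    by (auto simp: a_def b_def blinfun.add_left blinfun.diff_left algebra_simps
        scaleR_2[symmetric] simp flip: scaleR_add_left)
  have dc: "?d' ((blinfun_apply b ^^ m) x) \<le> C * 2 ^ m * ?c x" for x
  proof -
    have "?d' ((blinfun_apply b ^^ m) x) \<le> ?w x"
      unfolding hom by (rule word_form_id_bounds(1)[OF q0])
    also have "\<dots> \<le> C * ?wB x" by (rule C(2))
    also have "\<dots> \<le> C * (2 ^ m * ?c x)"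
      unfolding c using C(1) by (intro mult_left_mono word_form_id_bounds(2)[OF q0]) simp
    finally show ?thesis by (simp only: mult.assoc)
  qed
  have cd: "?c x \<le> C' * 2 ^ m * ?d' ((blinfun_apply b ^^ m) x)" for x
  proof -
    have "?c x \<le> ?wB x" unfolding c by (rule word_form_id_bounds(1)[OF q0])
    also have "\<dots> \<le> C' * ?wD ((blinfun_apply b ^^ m) x)" using C'(2) unfolding hom .
    also have "\<dots> \<le> C' * (2 ^ m * ?d' ((blinfun_apply b ^^ m) x))"
      using C'(1) by (intro mult_left_mono word_form_id_bounds(2)[OF q0]) simp
    finally show ?thesis by (simp only: mult.assoc)
  qed
  have Pb: "P (b x) = x" for x by (simp add: b_def blinfun.add_left inverse_left)
  have expand: "norm (T x) \<le> (norm S ^ Suc m + 1) * norm x"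
    if "\<And>x. T x = (blinfun_apply S ^^ Suc m) x" for T :: "'a \<Rightarrow> 'a" and S x
  proof -
    have "norm (T x) \<le> norm S ^ Suc m * norm x"
      using norm_op_pow_apply_le[of S "Suc m" x] unfolding op_pow_apply that .
    then show ?thesis by (simp add: distrib_right add_increasing2)
  qed
  show ?thesis
  proof
    assume "\<exists>\<kappa>>0. \<forall>x. \<kappa> * (norm x)\<^sup>2 \<le> ?c x"
    then show "\<exists>\<kappa>>0. \<forall>x. \<kappa> * (norm x)\<^sup>2 \<le> ?d x"
    proof (rule coercive_transfer[rotated -1])
      fix x
      \<comment> \<open>one more factor than \<open>m\<close>: the defect sum of \<open>D\<close> sees \<open>P x\<close> instead of \<open>x\<close>\<close>
      let ?y = "(blinfun_apply P ^^ Suc m) x"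
      have "(blinfun_apply b ^^ m) ?y = P x"
        using shift_pow_inverse(1)[of m "P x"] by (simp add: b_def funpow_swap1)
      then show "?c ?y \<le> C' * 2 ^ m / 4 * ?d x"
        using cd[of ?y] unfolding d by simp
      show "norm x \<le> (norm b ^ Suc m + 1) * norm ?y"
        using expand[of "blinfun_apply b ^^ Suc m" b ?y] shift_pow_inverse(1)[of "Suc m" x]
        by (simp only: b_def)
    qed (use C' in \<open>simp_all add: add_nonneg_pos\<close>)
  next
    assume "\<exists>\<kappa>>0. \<forall>x. \<kappa> * (norm x)\<^sup>2 \<le> ?d x"
    then show "\<exists>\<kappa>>0. \<forall>x. \<kappa> * (norm x)\<^sup>2 \<le> ?c x"
    proof (rule coercive_transfer[rotated -1])
      fix x
      let ?y = "(blinfun_apply b ^^ Suc m) x"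
      have "P ?y = (blinfun_apply b ^^ m) x" by (simp add: Pb)
      then show "?d ?y \<le> 4 * (C * 2 ^ m) * ?c x"
        using dc[of x] unfolding d by simp
      show "norm x \<le> (norm P ^ Suc m + 1) * norm ?y"
        using expand[of "blinfun_apply P ^^ Suc m" P ?y] shift_pow_inverse(2)[of "Suc m" x]
        by (simp only: b_def)
    qed (use C in \<open>simp_all add: add_nonneg_pos\<close>)
  qed
qed

end

section \<open>Lyapunov functions: from discrete to continuous stability\<close>

context cayley_pair
begin

text \<open>
  The finite sum \<open>v x = \<Sum>k<N. \<parallel>D\<^sup>k x\<parallel>\<^sup>2\<close> is an equivalent squared norm with
  \<open>v y - v (D y) = \<parallel>y\<parallel>\<^sup>2 - \<parallel>D\<^sup>N y\<parallel>\<^sup>2 \<ge> \<parallel>y\<parallel>\<^sup>2 / 2\<close>. For \<open>y = x + B x\<close> one has \<open>D y = x - B x\<close>, so the left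
  side is four times the polar form of \<open>v\<close> at \<open>(x, B x)\<close>, that is, minus twice the derivative of
  \<open>v\<close> along \<open>x' = -B x\<close>. Hence \<open>v\<close> is a strict Lyapunov function of the continuous system.
\<close>

lemma exp_stable_continuous_if_discrete:
  assumes "exp_stable_discrete D"
  shows "exp_stable_continuous (- B)"
proof -
  obtain C r where C: "1 \<le> C" and r: "0 < r" "r < 1"
    and stable: "\<And>x k. norm (op_pow D k x) \<le> C * r ^ k * norm x"
    using assms unfolding exp_stable_discrete_def by blast
  obtain n where n: "r ^ n < 1 / (2 * C)" using real_arch_pow_inv[of "1 / (2 * C)" r] r C by auto
  \<comment> \<open>\<open>N\<close> is positive, so that \<open>v\<close> contains the term \<open>\<parallel>x\<parallel>\<^sup>2\<close>\<close>
  define N where "N = Suc n"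
  have "r ^ N \<le> 1 / (2 * C)"
    using n power_decreasing[of n N r] r unfolding N_def by linarith
  then have CN: "C * r ^ N \<le> 1 / 2" using C by (simp add: field_simps)
  have half: "(norm (op_pow D N x))\<^sup>2 \<le> (norm x)\<^sup>2 / 2" for x
  proof -
    have "norm (op_pow D N x) \<le> 1 / 2 * norm x"
      by (rule order_trans[OF stable]) (intro mult_right_mono CN, simp)
    then have "(norm (op_pow D N x))\<^sup>2 \<le> (1 / 2 * norm x)\<^sup>2" by (intro power_mono) simp_all
    also have "\<dots> \<le> (norm x)\<^sup>2 / 2" by (simp add: power_mult_distrib power2_eq_square)
    finally show ?thesis .
  qed
  define v where "v x = (\<Sum>k<N. (norm (op_pow D k x))\<^sup>2)" for x
  define K where "K = (\<Sum>k<N. (norm D ^ k)\<^sup>2)"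
  have v_lower: "(norm x)\<^sup>2 \<le> v x" for x
    unfolding v_def using member_le_sum[of 0 "{..<N}" "\<lambda>k. (norm (op_pow D k x))\<^sup>2"]
    by (simp add: N_def)
  have v_upper: "v x \<le> K * (norm x)\<^sup>2" for x
    unfolding v_def K_def sum_distrib_right
    by (intro sum_mono) (simp only: power_mult_distrib[symmetric], intro power_mono norm_op_pow_apply_le, simp)
  have K: "1 \<le> K"
    unfolding K_def using member_le_sum[of 0 "{..<N}" "\<lambda>k. (norm D ^ k)\<^sup>2"] by (simp add: N_def)
  have v_D: "v x - v (D x) = (norm x)\<^sup>2 - (norm (op_pow D N x))\<^sup>2" for x
  proof -
    have "op_pow D k (D x) = op_pow D (Suc k) x" for k
      by (simp only: op_pow_apply funpow_swap1 funpow.simps o_apply)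
    then have "v x - v (D x) = (\<Sum>k\<le>n. (norm (op_pow D k x))\<^sup>2 - (norm (op_pow D (Suc k) x))\<^sup>2)"
      by (simp only: v_def N_def lessThan_Suc_atMost sum_subtractf)
    then show ?thesis
      using sum_defect_telescope[of "\<lambda>k. (norm (op_pow D k x))\<^sup>2" n] by (simp add: N_def)
  qed
  define L where "L = norm P + 1"
  have L: "0 < L" "norm x \<le> L * norm (x + B x)" for x
  proof -
    show "0 < L" by (simp add: L_def add_nonneg_pos)
    have "norm x \<le> norm P * norm (x + B x)"
      using norm_blinfun[of P "x + B x"] by (simp only: inverse_left)
    then show "norm x \<le> L * norm (x + B x)" by (simp add: L_def distrib_right add_increasing2)
  qed
  define \<omega> where "\<omega> = 1 / (8 * L\<^sup>2 * K)"
  have \<omega>: "0 < \<omega>" using L K by (simp add: \<omega>_def)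
  have dissipation: "\<omega> * v x \<le> (\<Sum>k<N. inner (op_pow D k x) (op_pow D k (B x)))" (is "_ \<le> ?s x") for x
  proof -
    have polar: "4 * inner y z = (norm (y + z))\<^sup>2 - (norm (y - z))\<^sup>2" for y z :: 'a
      by (simp add: power2_norm_eq_inner algebra_simps inner_commute)
    have "4 * ?s x = v (x + B x) - v (x - B x)"
      by (simp add: v_def sum_distrib_left polar blinfun.add_right blinfun.diff_right sum_subtractf)
    also have "\<dots> = (norm (x + B x))\<^sup>2 - (norm (op_pow D N (x + B x)))\<^sup>2"
      unfolding D_apply[symmetric] by (rule v_D)
    finally have "(norm (x + B x))\<^sup>2 \<le> 8 * ?s x" using half[of "x + B x"] by linarith
    then have "L\<^sup>2 * K * (norm (x + B x))\<^sup>2 \<le> L\<^sup>2 * K * (8 * ?s x)"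
      using K by (intro mult_left_mono) simp_all
    moreover have "v x \<le> L\<^sup>2 * K * (norm (x + B x))\<^sup>2"
    proof -
      have "(norm x)\<^sup>2 \<le> (L * norm (x + B x))\<^sup>2" using L(2) by (intro power_mono) simp_all
      then have "K * (norm x)\<^sup>2 \<le> K * (L * norm (x + B x))\<^sup>2" using K by (intro mult_left_mono) simp_all
      with v_upper[of x] show ?thesis by (simp add: power_mult_distrib mult_ac)
    qed
    ultimately have "v x \<le> 8 * L\<^sup>2 * K * ?s x" by simp
    then show ?thesis using L(1) K by (simp add: \<omega>_def field_simps)
  qed
  have "norm (op_exp (t *\<^sub>R (- B)) x) \<le> sqrt K * exp (- \<omega> * t) * norm x" if "0 \<le> t" for t x
  proof -
    define u where "u s = op_exp (s *\<^sub>R (- B)) x" for s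
    have u: "(u has_vector_derivative - B (u s)) (at s)" for s
      using op_exp_has_vector_derivative[of "- B" x s] by (simp add: u_def[abs_def] blinfun.minus_left)
    \<comment> \<open>the integrating factor turns the differential inequality \<open>v' \<le> -2 \<omega> v\<close> into monotonicity\<close>
    define g where "g s = exp (2 * \<omega> * s) * v (u s)" for s
    have sq: "((\<lambda>s. (norm (op_pow D k (u s)))\<^sup>2) has_real_derivative
        - 2 * inner (op_pow D k (u s)) (op_pow D k (B (u s)))) (at s)" for k s
    proof -
      have "((\<lambda>s. op_pow D k (u s)) has_vector_derivative op_pow D k (- B (u s))) (at s)"
        by (rule bounded_linear.has_vector_derivative[OF blinfun.bounded_linear_right u])
      then have "((\<lambda>s. inner (op_pow D k (u s)) (op_pow D k (u s))) has_derivative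
          (\<lambda>h. inner (op_pow D k (u s)) (h *\<^sub>R op_pow D k (- B (u s))) +
            inner (h *\<^sub>R op_pow D k (- B (u s))) (op_pow D k (u s)))) (at s)"
        unfolding has_vector_derivative_def by (intro has_derivative_inner)
      then show ?thesis
        unfolding has_field_derivative_def power2_norm_eq_inner
        by (rule has_derivative_eq_rhs) (simp add: fun_eq_iff blinfun.minus_right inner_commute)
    qed
    have g': "(g has_real_derivative 2 * exp (2 * \<omega> * s) *
        (\<omega> * v (u s) - (\<Sum>k<N. inner (op_pow D k (u s)) (op_pow D k (B (u s)))))) (at s)" for s
    proof -
      have "((\<lambda>s. v (u s)) has_real_derivative
          (\<Sum>k<N. - 2 * inner (op_pow D k (u s)) (op_pow D k (B (u s))))) (at s)"
        unfolding v_def by (intro DERIV_sum sq)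
      then show ?thesis unfolding g_def[abs_def]
        by (auto intro!: derivative_eq_intros simp: sum_negf sum_distrib_left[symmetric] algebra_simps)
    qed
    have "g t \<le> g 0"
    proof (rule DERIV_nonpos_imp_nonincreasing[OF that])
      fix s
      show "\<exists>y. (g has_real_derivative y) (at s) \<and> y \<le> 0"
        using g'[of s] dissipation[of "u s"] by (intro exI conjI) (assumption, simp add: mult_nonneg_nonpos)
    qed
    then have decay: "exp (2 * \<omega> * t) * v (u t) \<le> v x"
      using op_exp_zero[of "- B" x] by (simp add: g_def u_def)
    have "exp (2 * \<omega> * t) * (norm (u t))\<^sup>2 \<le> exp (2 * \<omega> * t) * v (u t)"
      by (intro mult_left_mono v_lower) simp
    also note decay
    also note v_upper[of x]
    finally have "(norm (u t))\<^sup>2 \<le> K * (norm x)\<^sup>2 * exp (- (2 * \<omega> * t))"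
      by (simp add: exp_minus field_simps)
    also have "exp (- (2 * \<omega> * t)) = (exp (- \<omega> * t))\<^sup>2"
      by (simp add: exp_double[symmetric])
    finally have "(norm (u t))\<^sup>2 \<le> (sqrt K * exp (- \<omega> * t) * norm x)\<^sup>2"
      using K by (simp add: power_mult_distrib mult_ac)
    then have "norm (u t) \<le> sqrt K * exp (- \<omega> * t) * norm x"
      by (rule power2_le_imp_le) (use K in simp)
    then show ?thesis by (simp only: u_def)
  qed
  moreover have "1 \<le> sqrt K" using K by simp
  ultimately show ?thesis unfolding exp_stable_continuous_def using \<omega> by blast
qed

end

section \<open>The Cayley transform and its inverse\<close>

lemma op_inverse_eqI:
  assumes "op_is_inverse A C"
  shows "op_inverse A = C"
  unfolding op_inverse_def
proof (rule the_equality[of "op_is_inverse A"])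
  fix C' assume C': "op_is_inverse A C'"
  have "C' x = C' (A (C x))" for x
    using assms unfolding op_is_inverse_def by (metis blinfun_apply_blinfun_compose blinfun_apply_id_blinfun id_apply)
  also have "\<dots> x = C x" for x
    using C' unfolding op_is_inverse_def by (metis blinfun_apply_blinfun_compose blinfun_apply_id_blinfun id_apply)
  finally show "C' = C" by (intro blinfun_eqI)
qed (rule assms)

lemma minus_one_resolvent:
  fixes A :: "'a::complex_hilbert \<Rightarrow>\<^sub>L 'a"
  assumes "- 1 \<notin> spectrum_op A"
  obtains C where "op_inverse (id_blinfun + A) = C" "C \<in> bounded_ops"
    "\<And>x. blinfun_apply C (x + blinfun_apply A x) = x"
    "\<And>x. blinfun_apply C x + blinfun_apply A (blinfun_apply C x) = x"
proof -
  have "scalar_op (- 1) = - (id_blinfun :: 'a \<Rightarrow>\<^sub>L 'a)"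
    using scaleC_of_real[of "- 1"] by (intro blinfun_eqI) (simp add: blinfun.minus_left)
  then have eq: "A - scalar_op (- 1) = id_blinfun + A" by simp
  obtain C where C: "op_is_inverse (id_blinfun + A) C"
    using assms eq unfolding spectrum_op_def by auto
  then have "blinfun_apply (C o\<^sub>L (id_blinfun + A)) x = x" "blinfun_apply ((id_blinfun + A) o\<^sub>L C) x = x" for x
    by (simp_all add: op_is_inverse_def)
  then show thesis
    using C op_inverse_eqI[OF C] by (intro that[of C]) (auto simp: op_is_inverse_def blinfun.add_left)
qed

lemma scaleC_diff_right: "c *\<^sub>C (x - y) = c *\<^sub>C x - c *\<^sub>C y" for x :: "'a::complex_hilbert"
  using scaleC_add_right[of c "x - y" y] by simp

lemma cayley_pair_index_iff:
  fixes B :: "'a::complex_hilbert \<Rightarrow>\<^sub>L 'a"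
  assumes "cayley_pair B D P" and B: "B \<in> bounded_ops" and D: "D \<in> bounded_ops"
  shows "has_hypocoercivity_index B m \<longleftrightarrow> has_hypocontractivity_index D m"
proof -
  interpret cayley_pair B D P by fact
  have herm: "op_nonneg (hermitian_part B) \<longleftrightarrow> (\<forall>x. 0 \<le> inner (B x) x)"
    unfolding op_nonneg_def cinner_hermitian_part[OF B] nonneg_Reals_of_real_iff ..
  have "coercive_op (hypocoercivity_sum B k) \<longleftrightarrow> coercive_op (hypocontractivity_sum D k)"
    if "\<forall>x. 0 \<le> inner (B x) x" for k
    unfolding coercive_hypocoercivity_sum_iff[OF B] coercive_hypocontractivity_sum_iff[OF D]
    using that by (intro coercive_sums_iff) blast
  then show ?thesis
    unfolding has_hypocoercivity_index_def has_hypocontractivity_index_def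
      contraction_iff_accretive herm by blast
qed

lemma hypocontractivity_index_imp_stable:
  fixes D :: "'a::complex_hilbert \<Rightarrow>\<^sub>L 'a"
  assumes "D \<in> bounded_ops" "has_hypocontractivity_index D m"
  shows "exp_stable_discrete D"
  using assms exp_stable_discrete_if_defect_coercive
  unfolding has_hypocontractivity_index_def coercive_hypocontractivity_sum_iff[OF assms(1)] by blast

lemma cayley_pair_cayley:
  fixes B :: "'a::complex_hilbert \<Rightarrow>\<^sub>L 'a"
  assumes B: "B \<in> bounded_ops" and "- 1 \<notin> spectrum_op B"
  shows "cayley (- B) \<in> bounded_ops" "\<exists>P. cayley_pair B (cayley (- B)) P"
proof -
  obtain P where P: "op_inverse (id_blinfun + B) = P" "P \<in> bounded_ops"
    "\<And>x. P (x + B x) = x" "\<And>x. P x + B (P x) = x"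
    using minus_one_resolvent[OF assms(2)] by blast
  have app: "cayley (- B) x = P x - B (P x)" for x
    using P(1) by (simp add: cayley_def blinfun.diff_left)
  show "cayley (- B) \<in> bounded_ops"
    using B P(2) by (simp add: bounded_ops_def app scaleC_diff_right)
  have "cayley_pair B (cayley (- B)) P"
    by unfold_locales (simp_all add: P(3,4) app)
  then show "\<exists>P. cayley_pair B (cayley (- B)) P" ..
qed

text \<open>
  With \<open>R = (I + D)\<^sup>-\<^sup>1\<close> and \<open>B = (I - D) R\<close> one finds \<open>I + B = 2 R\<close>, whose inverse is \<open>(I + D) / 2\<close>.
\<close>

lemma cayley_pair_inv_cayley:
  fixes D :: "'a::complex_hilbert \<Rightarrow>\<^sub>L 'a"
  assumes D: "D \<in> bounded_ops" and "- 1 \<notin> spectrum_op D"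
  shows "inv_cayley D \<in> bounded_ops" "\<exists>P. cayley_pair (- inv_cayley D) D P"
proof -
  obtain R where R: "op_inverse (id_blinfun + D) = R" "R \<in> bounded_ops"
    "\<And>x. R (x + D x) = x" "\<And>x. R x + D (R x) = x"
    using minus_one_resolvent[OF assms(2)] by blast
  have app: "inv_cayley D x = D (R x) - R x" for x
    using R(1) by (simp add: inv_cayley_def blinfun.diff_left add.commute)
  show "inv_cayley D \<in> bounded_ops"
    using D R(2) by (simp add: bounded_ops_def app scaleC_diff_right)
  have DR: "D (R x) = x - R x" for x using R(4)[of x] by (simp add: eq_diff_eq add.commute)
  have RD: "R (D x) = x - R x" for x using R(3)[of x] by (simp add: blinfun.add_right eq_diff_eq add.commute)
  have "cayley_pair (- inv_cayley D) D ((1 / 2) *\<^sub>R (id_blinfun + D))"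
    by unfold_locales
      (simp_all add: app DR RD blinfun.bilinear_simps scaleR_2[symmetric] algebra_simps)
  then show "\<exists>P. cayley_pair (- inv_cayley D) D P" ..
qed

theorem theorem4p12:
  assumes "separable_space (euclidean :: 'a::complex_hilbert topology)"
  shows
    "(\<forall>Bc\<in>(bounded_ops :: ('a \<Rightarrow>\<^sub>L 'a) set). - 1 \<notin> spectrum_op Bc \<longrightarrow>
        cayley (- Bc) \<in> bounded_ops \<and>
        (\<forall>m. exp_stable_continuous (- Bc) \<and> has_hypocoercivity_index Bc m \<longrightarrow>
          (let Bd = cayley (- Bc)
           in exp_stable_discrete Bd \<and> has_hypocontractivity_index Bd m))) \<and>
     (\<forall>Bd\<in>(bounded_ops :: ('a \<Rightarrow>\<^sub>L 'a) set). - 1 \<notin> spectrum_op Bd \<longrightarrow>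
        inv_cayley Bd \<in> bounded_ops \<and>
        (\<forall>m. exp_stable_discrete Bd \<and> has_hypocontractivity_index Bd m \<longrightarrow>
          (let Bc = - inv_cayley Bd
           in exp_stable_continuous (- Bc) \<and> has_hypocoercivity_index Bc m)))"
proof (intro conjI ballI impI allI)
  fix Bc :: "'a \<Rightarrow>\<^sub>L 'a"
  assume Bc: "Bc \<in> bounded_ops" "- 1 \<notin> spectrum_op Bc"
  show Bd: "cayley (- Bc) \<in> bounded_ops" by (rule cayley_pair_cayley(1)[OF Bc])
  obtain P where P: "cayley_pair Bc (cayley (- Bc)) P" using cayley_pair_cayley(2)[OF Bc] ..
  fix m
  assume "exp_stable_continuous (- Bc) \<and> has_hypocoercivity_index Bc m"
  then have "has_hypocontractivity_index (cayley (- Bc)) m"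
    using cayley_pair_index_iff[OF P Bc(1) Bd] by blast
  then show "let Bd = cayley (- Bc) in exp_stable_discrete Bd \<and> has_hypocontractivity_index Bd m"
    using hypocontractivity_index_imp_stable[OF Bd] by (simp add: Let_def)
next
  fix Bd :: "'a \<Rightarrow>\<^sub>L 'a"
  assume Bd: "Bd \<in> bounded_ops" "- 1 \<notin> spectrum_op Bd"
  show inv: "inv_cayley Bd \<in> bounded_ops" by (rule cayley_pair_inv_cayley(1)[OF Bd])
  then have Bc: "- inv_cayley Bd \<in> bounded_ops"
    using scaleC_diff_right[where 'a = 'a, of _ 0]
    by (simp add: bounded_ops_def blinfun.minus_left scaleC_add_right[of _ 0 0, simplified])
  obtain P where P: "cayley_pair (- inv_cayley Bd) Bd P" using cayley_pair_inv_cayley(2)[OF Bd] ..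
  fix m
  assume *: "exp_stable_discrete Bd \<and> has_hypocontractivity_index Bd m"
  then have "has_hypocoercivity_index (- inv_cayley Bd) m"
    using cayley_pair_index_iff[OF P Bc Bd(1)] by blast
  with * show "let Bc = - inv_cayley Bd in exp_stable_continuous (- Bc) \<and> has_hypocoercivity_index Bc m"
    using cayley_pair.exp_stable_continuous_if_discrete[OF P] by (simp add: Let_def)
qed

end
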